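(* Let $k\ge 1$ be an integer and let $n\ge 8$ and $s$ be positive integers with $s^2\equiv 1 \pmod n$ and $s\not\equiv \pm 1 \pmod n$. Suppose that $n=2n_1n_2$, where $n_1,n_2$ are coprime positive integers with $s\equiv -1 \pmod{n_1}$ and $s\equiv 1\pmod{n_2}$, and where either $n_1,n_2\ge 3$, or $n=2^t$ for some $t\ge 3$ and $(n_1,n_2)\in\{(1,2^{t-1}),(2^{t-1},1)\}$. Then $$\mathsf D_{\{1,s\}}(C_n^k)\ \le\ (k+1)\,\mathsf D_{\{1,s\}}(C_{n_1n_2}^k).$$
   Context: $C_m$ denotes the cyclic group of order $m$, written additively, and $C_m^k$ the direct sum of $k$ copies of it. A sequence over a finite abelian group $G$ is a finite unordered list of elements of $G$ with repetition allowed; its length is the number of terms counted with multiplicity. For a finite abelian group $G$ and a non-empty set $A\subset\mathbb Z$ containing no multiple of the exponent of $G$, the $A$-weighted Davenport constant $\mathsf D_A(G)$ is the smallest positive integer $D$ such that every sequence of length $D$ over $G$ has a non-empty subsequence $x_1,\dots,x_t$ with $\varepsilon_1x_1+\dots+\varepsilon_tx_t=0$ for some $\varepsilon_1,\dots,\varepsilon_t\in A$. *)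

theory Defs
  imports "HOL-Algebra.Elementary_Groups" "HOL-Algebra.Product_Groups"
    "HOL-Algebra.Multiplicative_Group" "HOL-Number_Theory.Cong" "HOL-Library.Multiset"
begin

text \<open>Groups are written multiplicatively in HOL-Algebra: the weighted sum
  \<open>\<epsilon>\<^sub>1 x\<^sub>1 + \<dots> + \<epsilon>\<^sub>t x\<^sub>t\<close> becomes a \<open>finprod\<close> of integer powers. Lists enumerate a
  subsequence only so that equal terms may receive different weights.\<close>

definition has_weighted_zero_sum_subseq ::
    "('a, 'b) monoid_scheme \<Rightarrow> int set \<Rightarrow> 'a multiset \<Rightarrow> bool" where
  "has_weighted_zero_sum_subseq G A S \<longleftrightarrow>
     (\<exists>xs es. xs \<noteq> [] \<and> mset xs \<subseteq># S \<and> length es = length xs \<and> set es \<subseteq> A \<and>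
        finprod G (\<lambda>i. (xs ! i) [^]\<^bsub>G\<^esub> (es ! i)) {..<length xs} = \<one>\<^bsub>G\<^esub>)"

text \<open>Intended for a finite abelian \<open>G\<close> and a non-empty \<open>A\<close> containing no multiple of the
  exponent of \<open>G\<close>. If \<open>A\<close> is non-empty the minimum is over a non-empty set, as shown below.\<close>

definition weighted_davenport :: "int set \<Rightarrow> ('a, 'b) monoid_scheme \<Rightarrow> nat" where
  "weighted_davenport A G =
     (LEAST D. D > 0 \<and>
        (\<forall>S. set_mset S \<subseteq> carrier G \<and> size S = D \<longrightarrow> has_weighted_zero_sum_subseq G A S))"

definition cyclic_power :: "nat \<Rightarrow> nat \<Rightarrow> (nat \<Rightarrow> int) monoid" where
  "cyclic_power m k = product_group {..<k} (\<lambda>_. integer_mod_group m)"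

lemma comm_group_cyclic_power: "comm_group (cyclic_power m k)"
proof -
  interpret group "cyclic_power m k"
    unfolding cyclic_power_def by simp
  show ?thesis
  proof (rule group_comm_groupI)
    fix x y
    assume "x \<in> carrier (cyclic_power m k)" "y \<in> carrier (cyclic_power m k)"
    then show "x \<otimes>\<^bsub>cyclic_power m k\<^esub> y = y \<otimes>\<^bsub>cyclic_power m k\<^esub> x"
      by (auto simp: cyclic_power_def integer_mod_group_def add.commute)
  qed
qed

lemma card_cyclic_power: "m > 0 \<Longrightarrow> card (carrier (cyclic_power m k)) = m ^ k"
  by (simp add: cyclic_power_def carrier_integer_mod_group card_PiE)

lemma ex_weighted_davenport:
  assumes "comm_group G" "finite (carrier G)" "A \<noteq> {}"
  shows "\<exists>D>0. \<forall>S. set_mset S \<subseteq> carrier G \<and> size S = D \<longrightarrow> has_weighted_zero_sum_subseq G A S"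
proof -
  interpret comm_group G by fact
  let ?N = "order G"
  have N: "?N > 0" using assms(2) by (simp add: order_gt_0_iff_finite)
  obtain a where a: "a \<in> A" using assms(3) by auto
  have "has_weighted_zero_sum_subseq G A S"
    if S: "set_mset S \<subseteq> carrier G" "size S = ?N * ?N" for S
  proof -
    obtain x where x: "x \<in> carrier G" "?N \<le> count S x"
    proof (rule ccontr)
      assume "\<not> thesis"
      then have lt: "count S x < ?N" if "x \<in> carrier G" for x
        using that \<open>\<And>x. x \<in> carrier G \<Longrightarrow> ?N \<le> count S x \<Longrightarrow> thesis\<close> by force
      have "size S = (\<Sum>x\<in>carrier G. count S x)"
        unfolding size_multiset_overloaded_eq
        by (rule sum.mono_neutral_left) (use S assms(2) in \<open>auto simp: not_in_iff\<close>)
      also have "\<dots> < (\<Sum>x\<in>carrier G. ?N)"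
        using lt assms(2) by (intro sum_strict_mono) auto
      finally show False using S(2) by (simp add: order_def)
    qed
    have "finprod G (\<lambda>i. replicate ?N x ! i [^]\<^bsub>G\<^esub> (replicate ?N a ! i)) {..<?N} =
        finprod G (\<lambda>i. x [^]\<^bsub>G\<^esub> a) {..<?N}"
      using x(1) by (intro finprod_cong') auto
    also have "\<dots> = \<one>\<^bsub>G\<^esub>"
      using x(1) by (simp add: finprod_const pow_order_eq_1)
    finally show ?thesis
      unfolding has_weighted_zero_sum_subseq_def using N a x(2)
      by (intro exI[of _ "replicate ?N x"] exI[of _ "replicate ?N a"])
        (auto simp: subseteq_mset_def)
  qed
  then show ?thesis using N by (intro exI[of _ "?N * ?N"]) auto
qed

end

theory Submission
  imports Defs
begin

text \<open>
  Put \<open>m = n1 * n2\<close> and let \<open>D\<close> be the \<open>{1, s}\<close>-weighted Davenport constant of \<open>C\<^sub>m\<^sup>k\<close>. Reduction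
  modulo \<open>m\<close> is a homomorphism from \<open>C\<^sub>2\<^sub>m\<^sup>k\<close> to \<open>C\<^sub>m\<^sup>k\<close> whose kernel consists of the vectors with all
  entries in \<open>{0, m}\<close>; it is elementary abelian of order \<open>2\<^sup>k\<close>. Cut a sequence of length
  \<open>(k + 1) * D\<close> over \<open>C\<^sub>2\<^sub>m\<^sup>k\<close> into \<open>k + 1\<close> blocks of length \<open>D\<close>. By the choice of \<open>D\<close> each block has a
  non-empty subsequence with a weighted sum in the kernel. As \<open>k + 1\<close> vectors over the field with
  two elements are linearly dependent in dimension \<open>k\<close>, some non-empty set of these weighted sums
  adds up to zero without further weights, and so the chosen subsequences of the corresponding
  blocks, put together, have weighted sum zero.

  The second step has to be unweighted, so that every term keeps the weight it received in its
  block. The general form of the block argument is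
  \<open>weighted_davenport_le_mult_of_hom\<close>, and the dependence in the kernel is
  \<open>elementary_2_group_unweighted_zero_sum\<close>.
\<close>

section \<open>Weighted products along lists\<close>

text \<open>With the terms and their weights paired up in a list, combining subsequences taken from
  different blocks is list concatenation; no index sets have to be shifted.\<close>

fun weighted_prod :: "('a, 'b) monoid_scheme \<Rightarrow> ('a \<times> int) list \<Rightarrow> 'a" where
  "weighted_prod G [] = \<one>\<^bsub>G\<^esub>"
| "weighted_prod G ((x, e) # zs) = x [^]\<^bsub>G\<^esub> e \<otimes>\<^bsub>G\<^esub> weighted_prod G zs"

lemma (in group) weighted_prod_closed:
  "fst ` set zs \<subseteq> carrier G \<Longrightarrow> weighted_prod G zs \<in> carrier G"
  by (induction zs) (auto intro!: m_closed)

lemma (in group) weighted_prod_append: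
  "fst ` set xs \<subseteq> carrier G \<Longrightarrow> fst ` set ys \<subseteq> carrier G \<Longrightarrow>
    weighted_prod G (xs @ ys) = weighted_prod G xs \<otimes> weighted_prod G ys"
  by (induction xs) (auto simp: weighted_prod_closed m_assoc)

lemma (in group) weighted_prod_concat:
  assumes "\<And>zs. zs \<in> set zss \<Longrightarrow> fst ` set zs \<subseteq> carrier G"
  shows "weighted_prod G (concat zss) = weighted_prod G (map (\<lambda>zs. (weighted_prod G zs, 1)) zss)"
  using assms
proof (induction zss)
  case (Cons zs zss)
  have "fst ` set (concat zss) \<subseteq> carrier G"
    using Cons.prems by fastforce
  then show ?case
    using Cons by (simp add: weighted_prod_append weighted_prod_closed)
qed simp

lemma (in group_hom) hom_weighted_prod:
  "fst ` set zs \<subseteq> carrier G \<Longrightarrow>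
    h (weighted_prod G zs) = weighted_prod H (map (\<lambda>(x, e). (h x, e)) zs)"
  by (induction zs) (auto simp: G.weighted_prod_closed hom_int_pow)

lemma (in comm_group) weighted_prod_eq_finprod:
  assumes "distinct js" "\<And>i. i \<in> set js \<Longrightarrow> fst (g i) \<in> carrier G"
  shows "weighted_prod G (map g js) = finprod G (\<lambda>i. fst (g i) [^] snd (g i)) (set js)"
  using assms
proof (induction js)
  case (Cons i js)
  obtain x e where g: "g i = (x, e)" by force
  then have "x \<in> carrier G" using Cons.prems(2)[of i] by simp
  then show ?case
    using Cons g by simp
qed simp

text \<open>The bridge to the defining formulation, in which a weighted subsequence is a pair of lists of
  equal length and its sum is indexed by positions.\<close>

lemma (in comm_group) has_weighted_zero_sum_subseq_iff:
  assumes S: "set_mset S \<subseteq> carrier G"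
  shows "has_weighted_zero_sum_subseq G A S \<longleftrightarrow>
    (\<exists>zs. zs \<noteq> [] \<and> mset (map fst zs) \<subseteq># S \<and> snd ` set zs \<subseteq> A \<and> weighted_prod G zs = \<one>)"
    (is "?L \<longleftrightarrow> ?R")
proof -
  have eq: "weighted_prod G zs =
      finprod G (\<lambda>i. map fst zs ! i [^] (map snd zs ! i)) {..<length zs}"
    if "mset (map fst zs) \<subseteq># S" for zs
  proof -
    have "fst ` set zs \<subseteq> carrier G"
      using set_mset_mono[OF that] S by auto
    then have cl: "fst (zs ! i) \<in> carrier G" if "i < length zs" for i
      using that by (meson image_subset_iff nth_mem)
    have "weighted_prod G (map ((!) zs) [0..<length zs]) =
        finprod G (\<lambda>i. fst (zs ! i) [^] snd (zs ! i)) (set [0..<length zs])"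
      by (rule weighted_prod_eq_finprod) (use cl in auto)
    also have "\<dots> = finprod G (\<lambda>i. map fst zs ! i [^] (map snd zs ! i)) {..<length zs}"
      by (rule finprod_cong') (use cl in auto)
    finally show ?thesis by (simp add: map_nth)
  qed
  show ?thesis
  proof
    assume ?L
    then obtain xs es where *: "xs \<noteq> []" "mset xs \<subseteq># S" "length es = length xs" "set es \<subseteq> A"
        "finprod G (\<lambda>i. (xs ! i) [^] (es ! i)) {..<length xs} = \<one>"
      unfolding has_weighted_zero_sum_subseq_def by blast
    let ?zs = "zip xs es"
    have m: "map fst ?zs = xs" "map snd ?zs = es"
      using *(3) by simp_all
    have "snd ` set ?zs = set es"
      using m(2) by (metis list.set_map)
    moreover have "?zs \<noteq> []"
      using * by auto
    moreover have "weighted_prod G ?zs = \<one>"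
      using eq[of ?zs] * m by simp
    ultimately show ?R
      using * m by (metis (no_types, lifting))
  next
    assume ?R
    then obtain zs where *: "zs \<noteq> []" "mset (map fst zs) \<subseteq># S" "snd ` set zs \<subseteq> A"
        "weighted_prod G zs = \<one>"
      by blast
    then show ?L
      unfolding has_weighted_zero_sum_subseq_def using eq[of zs]
      by (intro exI[of _ "map fst zs"] exI[of _ "map snd zs"]) auto
  qed
qed

section \<open>Davenport constants and homomorphisms\<close>

lemma weighted_davenport_spec:
  assumes "comm_group G" "finite (carrier G)" "A \<noteq> {}"
  shows "weighted_davenport A G > 0 \<and>
    (\<forall>S. set_mset S \<subseteq> carrier G \<and> size S = weighted_davenport A G \<longrightarrow>
      has_weighted_zero_sum_subseq G A S)"
  unfolding weighted_davenport_def by (rule LeastI_ex) (use ex_weighted_davenport[OF assms] in auto)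

lemma ex_submset_of_size:
  assumes "d \<le> size S"
  obtains T where "T \<subseteq># S" "size T = d"
proof -
  obtain xs where xs: "mset xs = S" using ex_mset by blast
  have "mset (take d xs) + mset (drop d xs) = S"
    by (simp add: xs flip: mset_append)
  then have "mset (take d xs) \<subseteq># S"
    by (metis mset_subset_eq_add_left)
  moreover have "size (mset (take d xs)) = d"
    using assms xs by auto
  ultimately show thesis by (rule that)
qed

lemma submset_of_map_lift:
  "mset ys \<subseteq># mset (map f bs) \<Longrightarrow> \<exists>cs. mset cs \<subseteq># mset bs \<and> map f cs = ys"
proof (induction ys arbitrary: bs)
  case (Cons y ys)
  then have "y \<in> set (map f bs)"
    by (metis list.set_intros(1) mset_subset_eqD set_mset_mset)
  then obtain b where b: "b \<in> set bs" "f b = y" by auto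
  have bs: "mset bs = add_mset b (mset (remove1 b bs))"
    using b by simp
  have "mset (map f bs) = add_mset y (mset (map f (remove1 b bs)))"
    using b bs by (metis image_mset_add_mset mset_map)
  then have "mset ys \<subseteq># mset (map f (remove1 b bs))"
    using Cons.prems by simp
  then obtain cs where cs: "mset cs \<subseteq># mset (remove1 b bs)" "map f cs = ys"
    using Cons.IH by blast
  then show ?case
    using b bs by (intro exI[of _ "b # cs"]) (metis list.simps(9) mset.simps(2) mset_subset_eq_add_mset_cancel)
qed simp

lemma mset_concat_mono:
  assumes "mset xss \<subseteq># mset yss"
  shows "mset (concat xss) \<subseteq># mset (concat yss)"
proof -
  obtain R where R: "mset yss = mset xss + R"
    using assms mset_subset_eq_exists_conv by blast
  have c: "mset (concat zss) = \<Sum>\<^sub># (image_mset mset (mset zss))" for zss :: "'a list list"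
    by (induction zss) auto
  show ?thesis
    by (simp add: c R)
qed

text \<open>Each block is cut off and handled by the defining property of \<open>D\<close> for the image group \<open>H\<close>.
  The chosen subsequences stay disjoint inside \<open>S\<close> because every block is removed before the
  next one is taken.\<close>

lemma (in group_hom) ex_blocks_in_kernel:
  assumes H: "comm_group H"
    and D: "\<And>T. set_mset T \<subseteq> carrier H \<Longrightarrow> size T = D \<Longrightarrow> has_weighted_zero_sum_subseq H A T"
    and S: "set_mset S \<subseteq> carrier G" "size S = r * D"
  shows "\<exists>zss. length zss = r \<and> mset (map fst (concat zss)) \<subseteq># S \<and>
    (\<forall>zs\<in>set zss. zs \<noteq> [] \<and> snd ` set zs \<subseteq> A \<and> weighted_prod G zs \<in> kernel G H h)"
  using S
proof (induction r arbitrary: S)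
  case (Suc r)
  have "D \<le> size S" using Suc.prems by simp
  then obtain T where T: "T \<subseteq># S" "size T = D" by (rule ex_submset_of_size)
  then have TG: "set_mset T \<subseteq> carrier G"
    using Suc.prems(1) set_mset_mono by blast
  have hT: "set_mset (image_mset h T) \<subseteq> carrier H"
    using TG by auto
  obtain ws where ws: "ws \<noteq> []" "mset (map fst ws) \<subseteq># image_mset h T" "snd ` set ws \<subseteq> A"
      "weighted_prod H ws = \<one>\<^bsub>H\<^esub>"
    using D[OF hT] T(2) comm_group.has_weighted_zero_sum_subseq_iff[OF H hT, of A] by auto
  obtain ts where ts: "mset ts = T" using ex_mset by blast
  have "mset (map fst ws) \<subseteq># mset (map h ts)"
    using ws(2) by (simp add: ts)
  then obtain xs where xs: "mset xs \<subseteq># mset ts" "map h xs = map fst ws"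
    using submset_of_map_lift by metis
  define zs where "zs = zip xs (map snd ws)"
  have len: "length xs = length ws"
    using xs(2) by (metis length_map)
  have fst_zs: "map fst zs = xs" and snd_zs: "map snd zs = map snd ws"
    using len by (simp_all add: zs_def)
  have "map (\<lambda>(x, e). (h x, e)) zs = zip (map h xs) (map snd ws)"
    by (simp add: zs_def zip_map1)
  also have "\<dots> = ws"
    using xs(2) by (simp add: zip_map_fst_snd)
  finally have h_zs: "map (\<lambda>(x, e). (h x, e)) zs = ws" .
  have zsG: "fst ` set zs \<subseteq> carrier G"
    using fst_zs xs(1) ts TG set_mset_mono by (metis list.set_map set_mset_mset subset_trans)
  have zs: "zs \<noteq> []" "snd ` set zs \<subseteq> A" "weighted_prod G zs \<in> kernel G H h"
  proof -
    show "zs \<noteq> []" using h_zs ws(1) by auto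
    show "snd ` set zs \<subseteq> A" using snd_zs ws(3) by (metis list.set_map)
    show "weighted_prod G zs \<in> kernel G H h"
      using hom_weighted_prod[OF zsG] h_zs ws(4) G.weighted_prod_closed[OF zsG]
      by (simp add: kernel_def)
  qed
  have "set_mset (S - T) \<subseteq> carrier G" "size (S - T) = r * D"
    using Suc.prems T by (auto simp: size_Diff_submset dest: in_diffD)
  then obtain zss where zss: "length zss = r" "mset (map fst (concat zss)) \<subseteq># S - T"
      "\<forall>zs\<in>set zss. zs \<noteq> [] \<and> snd ` set zs \<subseteq> A \<and> weighted_prod G zs \<in> kernel G H h"
    using Suc.IH by blast
  have "mset (map fst (concat (zs # zss))) = mset xs + mset (map fst (concat zss))"
    by (simp add: fst_zs[symmetric])
  also have "\<dots> \<subseteq># T + (S - T)"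
    using xs(1) ts zss(2) by (intro subset_mset.add_mono) auto
  also have "\<dots> = S" using T(1) by simp
  finally show ?case
    using zss zs by (intro exI[of _ "zs # zss"]) auto
qed simp

text \<open>The kernel is tested with the single weight \<open>1\<close>: a weight \<open>a\<close> on the product of a block would
  multiply every weight \<open>e\<close> chosen inside that block, and \<open>a * e\<close> may lie outside \<open>A\<close>.\<close>

theorem weighted_davenport_le_mult_of_hom:
  assumes G: "comm_group G" and H: "comm_group H" "finite (carrier H)" and h: "h \<in> hom G H"
    and A: "A \<noteq> {}" and r: "r > 0"
    and ker: "\<And>Y. set_mset Y \<subseteq> kernel G H h \<Longrightarrow> size Y = r \<Longrightarrow>
      has_weighted_zero_sum_subseq G {1} Y"
  shows "weighted_davenport A G \<le> r * weighted_davenport A H"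
proof -
  interpret G: comm_group G by fact
  interpret H: comm_group H by fact
  interpret group_hom G H h
    using h by unfold_locales
  define D where "D = weighted_davenport A H"
  have D: "D > 0"
      "\<And>T. set_mset T \<subseteq> carrier H \<Longrightarrow> size T = D \<Longrightarrow> has_weighted_zero_sum_subseq H A T"
    using weighted_davenport_spec[OF H A] by (auto simp: D_def)
  have "has_weighted_zero_sum_subseq G A S"
    if S: "set_mset S \<subseteq> carrier G" "size S = r * D" for S
  proof -
    obtain zss where zss: "length zss = r" "mset (map fst (concat zss)) \<subseteq># S"
        "\<forall>zs\<in>set zss. zs \<noteq> [] \<and> snd ` set zs \<subseteq> A \<and> weighted_prod G zs \<in> kernel G H h"
      using ex_blocks_in_kernel[OF H(1) D(2) S] by blast
    have carr: "fst ` set zs \<subseteq> carrier G" if "zs \<in> set zss" for zs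
      using set_mset_mono[OF zss(2)] S(1) that by fastforce
    define Y where "Y = mset (map (weighted_prod G) zss)"
    have Y: "set_mset Y \<subseteq> kernel G H h" "size Y = r"
      using zss by (auto simp: Y_def)
    moreover have "set_mset Y \<subseteq> carrier G"
      using Y(1) by (auto simp: kernel_def)
    ultimately obtain ws where ws: "ws \<noteq> []" "mset (map fst ws) \<subseteq># Y" "snd ` set ws \<subseteq> {1}"
        "weighted_prod G ws = \<one>\<^bsub>G\<^esub>"
      using ker G.has_weighted_zero_sum_subseq_iff by metis
    obtain css where css: "mset css \<subseteq># mset zss" "map (weighted_prod G) css = map fst ws"
      using submset_of_map_lift ws(2) unfolding Y_def by metis
    have sub: "set css \<subseteq> set zss"
      using set_mset_mono[OF css(1)] by simp
    have "ws = map (\<lambda>x. (x, 1)) (map fst ws)"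
      using ws(3) by (induction ws) auto
    then have "ws = map (\<lambda>zs. (weighted_prod G zs, 1)) css"
      by (simp flip: css(2) add: comp_def)
    then have "weighted_prod G (concat css) = \<one>\<^bsub>G\<^esub>"
      using G.weighted_prod_concat[of css] sub carr ws(4) by auto
    moreover have "mset (map fst (concat css)) \<subseteq># S"
      using image_mset_subseteq_mono[OF mset_concat_mono[OF css(1)], of fst] zss(2)
      by (simp add: subset_mset.trans)
    moreover have "concat css \<noteq> []"
    proof -
      have "css \<noteq> []" using css(2) ws(1) by auto
      then show ?thesis using sub zss(3) by (cases css) auto
    qed
    moreover have "snd ` set (concat css) \<subseteq> A"
      using sub zss(3) by fastforce
    ultimately show ?thesis
      using G.has_weighted_zero_sum_subseq_iff[OF S(1)] by blast
  qed
  then show ?thesis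
    unfolding weighted_davenport_def[of A G] D_def[symmetric]
    using r D(1) by (intro Least_le) auto
qed

section \<open>Zero-sum subsequences in elementary 2-groups\<close>

text \<open>A counting form of linear dependence over the field with two elements: the \<open>2\<^sup>r\<close> partial
  products cannot be distinct, and if two of them agree, all factors that they share cancel, so
  the product over the symmetric difference of the two index sets is trivial.\<close>

lemma (in comm_group) elementary_2_group_unweighted_zero_sum:
  assumes K: "subgroup K G" "finite K" "card K < 2 ^ r"
    and sq: "\<And>x. x \<in> K \<Longrightarrow> x \<otimes> x = \<one>"
    and Y: "set_mset Y \<subseteq> K" "size Y = r"
  shows "has_weighted_zero_sum_subseq G {1} Y"
proof -
  interpret K: subgroup K G by fact
  obtain ys where ys: "mset ys = Y" using ex_mset by blast
  have len: "length ys = r" using ys Y(2) by auto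
  have nthK: "ys ! i \<in> K" if "i < r" for i
    using that len ys Y(1) by (metis nth_mem set_mset_mset subsetD)
  have nthG: "ys ! i \<in> carrier G" if "i < r" for i
    using nthK[OF that] K.subset by blast
  define f where "f I = finprod G ((!) ys) I" for I
  have fK: "f I \<in> K" if "I \<subseteq> {..<r}" for I
  proof -
    have "finite I" using that finite_subset by blast
    then show ?thesis using that
    proof (induction I)
      case (insert i I)
      then have "f (insert i I) = ys ! i \<otimes> f I"
        unfolding f_def using nthG by (intro finprod_insert) auto
      then show ?case
        using insert nthK by auto
    qed (simp add: f_def)
  qed
  have fU: "f (I \<union> J) = f I \<otimes> f J" if "I \<subseteq> {..<r}" "J \<subseteq> {..<r}" "I \<inter> J = {}" for I J
    unfolding f_def using that nthG finite_subset[OF that(1)] finite_subset[OF that(2)]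
    by (intro finprod_Un_disjoint) auto
  have fG: "f I \<in> carrier G" if "I \<subseteq> {..<r}" for I
    using fK[OF that] K.subset by blast
  have "\<not> inj_on f (Pow {..<r})"
  proof
    assume "inj_on f (Pow {..<r})"
    then have "card (Pow {..<r}) \<le> card K"
      by (rule card_inj_on_le) (use fK K(2) in auto)
    then show False using K(3) by (simp add: card_Pow)
  qed
  then obtain I J where IJ: "I \<subseteq> {..<r}" "J \<subseteq> {..<r}" "I \<noteq> J" "f I = f J"
    by (auto simp: inj_on_def)
  have "f (I \<inter> J) \<otimes> f (I - J) = f (I \<inter> J) \<otimes> f (J - I)"
  proof -
    have "f (I \<inter> J) \<otimes> f (I - J) = f I"
      by (subst fU[symmetric]) (use IJ in \<open>auto simp: Int_Diff_Un\<close>)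
    moreover have "f (I \<inter> J) \<otimes> f (J - I) = f J"
      by (subst fU[symmetric]) (use IJ in \<open>auto intro!: arg_cong[where f = f]\<close>)
    ultimately show ?thesis using IJ(4) by simp
  qed
  moreover have sub: "I \<inter> J \<subseteq> {..<r}" "I - J \<subseteq> {..<r}" "J - I \<subseteq> {..<r}"
    using IJ by auto
  ultimately have eq: "f (I - J) = f (J - I)"
    using fG by simp
  define L where "L = (I - J) \<union> (J - I)"
  have L: "L \<subseteq> {..<r}" "L \<noteq> {}" "finite L"
    using IJ finite_subset[of L "{..<r}"] by (auto simp: L_def)
  have "f L = f (I - J) \<otimes> f (J - I)"
    unfolding L_def using sub by (intro fU) auto
  then have fL: "f L = \<one>"
    using eq sq[OF fK[OF sub(3)]] by simp
  define js where "js = sorted_list_of_set L"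
  have js: "distinct js" "set js = L"
    using L(3) by (simp_all add: js_def)
  have "weighted_prod G (map (\<lambda>i. (ys ! i, 1)) js) = finprod G (\<lambda>i. ys ! i [^] (1::int)) L"
    using weighted_prod_eq_finprod[OF js(1), of "\<lambda>i. (ys ! i, 1)"] js(2) L(1) nthG by auto
  also have "\<dots> = f L"
    unfolding f_def using L(1) nthG by (intro finprod_cong') (auto simp: int_pow_1)
  finally have prod: "weighted_prod G (map (\<lambda>i. (ys ! i, 1)) js) = \<one>"
    using fL by simp
  have "mset (map ((!) ys) js) \<subseteq># mset (map ((!) ys) [0..<r])"
  proof -
    have "mset js \<subseteq># mset [0..<r]"
      using js L by (metis atLeast0LessThan distinct_upt finite_lessThan mset_set_set set_upt
          subset_imp_msubset_mset_set)
    then show ?thesis by (simp add: image_mset_subseteq_mono del: mset_upt)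
  qed
  then have "mset (map ((!) ys) js) \<subseteq># Y"
    using ys len map_nth by metis
  moreover have "set_mset Y \<subseteq> carrier G"
    using Y(1) K.subset by blast
  ultimately show ?thesis
    using prod L(2) js(2) has_weighted_zero_sum_subseq_iff
    by (intro iffD2[OF has_weighted_zero_sum_subseq_iff] exI[of _ "map (\<lambda>i. (ys ! i, 1)) js"])
      (auto simp: comp_def)
qed

section \<open>Reduction of cyclic powers\<close>

lemma finite_carrier_cyclic_power: "m > 0 \<Longrightarrow> finite (carrier (cyclic_power m k))"
  by (auto simp: cyclic_power_def carrier_integer_mod_group intro!: finite_PiE)

lemma cyclic_power_reduction_hom:
  assumes "m > 0" "n > 0" "m dvd n"
  shows "(\<lambda>x. \<lambda>i\<in>{..<k}. x i mod int m) \<in> hom (cyclic_power n k) (cyclic_power m k)"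
proof (rule homI)
  fix x y
  assume "x \<in> carrier (cyclic_power n k)" "y \<in> carrier (cyclic_power n k)"
  show "(\<lambda>i\<in>{..<k}. (x \<otimes>\<^bsub>cyclic_power n k\<^esub> y) i mod int m) =
      (\<lambda>i\<in>{..<k}. x i mod int m) \<otimes>\<^bsub>cyclic_power m k\<^esub> (\<lambda>i\<in>{..<k}. y i mod int m)"
    using assms(3) by (auto simp: cyclic_power_def fun_eq_iff mod_mod_cancel mod_add_eq)
qed (use assms in \<open>auto simp: cyclic_power_def carrier_integer_mod_group\<close>)

lemma kernel_cyclic_power_halving:
  assumes "m > 0"
  shows "kernel (cyclic_power (2 * m) k) (cyclic_power m k) (\<lambda>x. \<lambda>i\<in>{..<k}. x i mod int m)
    \<subseteq> (\<Pi>\<^sub>E i\<in>{..<k}. {0, int m})"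
proof
  fix x
  assume "x \<in> kernel (cyclic_power (2 * m) k) (cyclic_power m k) (\<lambda>x. \<lambda>i\<in>{..<k}. x i mod int m)"
  then have x: "x \<in> (\<Pi>\<^sub>E i\<in>{..<k}. {0..<2 * int m})"
      "(\<lambda>i\<in>{..<k}. x i mod int m) = (\<lambda>i\<in>{..<k}. 0)"
    using assms by (auto simp: kernel_def cyclic_power_def carrier_integer_mod_group)
  have "x i \<in> {0, int m}" if "i < k" for i
  proof -
    have "x i mod int m = 0"
      using fun_cong[OF x(2), of i] that by simp
    then obtain q where q: "x i = int m * q" by auto
    have bounds: "0 \<le> int m * q" "int m * q < 2 * int m"
      using PiE_mem[OF x(1), of i] that q by simp_all
    have "0 \<le> q"
      using bounds(1) assms by (simp add: zero_le_mult_iff)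
    moreover have "q < 2"
      using bounds(2) assms by (metis mult.commute mult_less_cancel_left_pos of_nat_0_less_iff)
    ultimately have "q = 0 \<or> q = 1" by linarith
    then show ?thesis using q by auto
  qed
  then show "x \<in> (\<Pi>\<^sub>E i\<in>{..<k}. {0, int m})"
    using x(1) by (auto simp: PiE_iff)
qed

theorem weighted_davenport_cyclic_power_double:
  assumes m: "m > 0" and A: "A \<noteq> {}"
  shows "weighted_davenport A (cyclic_power (2 * m) k)
    \<le> (k + 1) * weighted_davenport A (cyclic_power m k)"
proof -
  let ?G = "cyclic_power (2 * m) k" and ?H = "cyclic_power m k"
  let ?h = "\<lambda>x. \<lambda>i\<in>{..<k}. x i mod int m"
  interpret G: comm_group ?G by (rule comm_group_cyclic_power)
  interpret H: comm_group ?H by (rule comm_group_cyclic_power)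
  have hom: "?h \<in> hom ?G ?H"
    by (rule cyclic_power_reduction_hom) (use m in auto)
  interpret group_hom ?G ?H ?h
    using hom by unfold_locales
  let ?K = "kernel ?G ?H ?h"
  have K: "?K \<subseteq> (\<Pi>\<^sub>E i\<in>{..<k}. {0, int m})"
    by (rule kernel_cyclic_power_halving[OF m])
  have fin: "finite (\<Pi>\<^sub>E i\<in>{..<k}. {0, int m})"
    by (intro finite_PiE) auto
  have "card ?K \<le> 2 ^ k"
    using card_mono[OF fin K] m by (simp add: card_PiE numeral_2_eq_2)
  then have card: "card ?K < 2 ^ (k + 1)"
    by (rule le_less_trans) simp
  have sq: "x \<otimes>\<^bsub>?G\<^esub> x = \<one>\<^bsub>?G\<^esub>" if "x \<in> ?K" for x
  proof -
    have "x i = 0 \<or> x i = int m" if "i < k" for i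
      using \<open>x \<in> ?K\<close> K that by (auto simp: PiE_iff)
    then show ?thesis
      by (fastforce simp: cyclic_power_def intro!: restrict_ext)
  qed
  show ?thesis
  proof (rule weighted_davenport_le_mult_of_hom[OF G.comm_group_axioms H.comm_group_axioms])
    show "has_weighted_zero_sum_subseq ?G {1} Y" if "set_mset Y \<subseteq> ?K" "size Y = k + 1" for Y
      by (rule G.elementary_2_group_unweighted_zero_sum[OF subgroup_kernel
            finite_subset[OF K fin] card sq that])
  qed (use hom A m in \<open>auto intro: finite_carrier_cyclic_power\<close>)
qed

theorem proposition5p1:
  fixes k n n1 n2 :: nat and s :: int
  assumes "k \<ge> 1" and "n \<ge> 8" and "s > 0"
    and "[s ^ 2 = 1] (mod int n)"
    and "\<not> [s = 1] (mod int n)" and "\<not> [s = - 1] (mod int n)"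
    and "n1 > 0" and "n2 > 0" and "coprime n1 n2" and "n = 2 * n1 * n2"
    and "[s = - 1] (mod int n1)" and "[s = 1] (mod int n2)"
    and "(n1 \<ge> 3 \<and> n2 \<ge> 3) \<or>
         (\<exists>t\<ge>3. n = 2 ^ t \<and> (n1, n2) \<in> {(1, 2 ^ (t - 1)), (2 ^ (t - 1), 1)})"
  shows "weighted_davenport {1, s} (cyclic_power n k)
           \<le> (k + 1) * weighted_davenport {1, s} (cyclic_power (n1 * n2) k)"
proof -
  have "n1 * n2 > 0" using \<open>n1 > 0\<close> \<open>n2 > 0\<close> by simp
  from weighted_davenport_cyclic_power_double[OF this, of "{1, s}" k]
  show ?thesis using \<open>n = 2 * n1 * n2\<close> by (simp add: mult.assoc)
qed

end
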